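(* Let $S_{1},S_{2}$ be multiplicatively closed subsets of rings $R_{1}$, $R_{2}$ respectively, and let $N_{1}$, $N_{2}$ be non-zero submodules of an $R_{1}$-module $M_{1}$ and an $R_{2}$-module $M_{2}$, respectively. Consider $M=M_{1}\times M_{2}$ as an $(R_{1}\times R_{2})$-module, $S=S_{1}\times S_{2}$ and $N=N_{1}\times N_{2}$. Then the following are equivalent. (1) $N$ is a weakly $S$-prime submodule of $M$. (2) Either $N_{1}$ is an $S_{1}$-prime submodule of $M_{1}$ and $(N_{2}:_{R_{2}}M_{2})\cap S_{2}\neq\emptyset$, or $N_{2}$ is an $S_{2}$-prime submodule of $M_{2}$ and $(N_{1}:_{R_{1}}M_{1})\cap S_{1}\neq\emptyset$. (3) $N$ is an $S$-prime submodule of $M$.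
   Context: Rings are commutative with non-zero identity and modules are unital. A non-empty subset $S$ of $R$ is multiplicatively closed if it is closed under multiplication. For a submodule $N$ of an $R$-module $M$, $(N:_{R}M)=\{r\in R: rM\subseteq N\}$. The ring $R_1\times R_2$ acts on $M_1\times M_2$ componentwise. A submodule $N$ of an $R$-module $M$ with $(N:_{R}M)\cap S=\emptyset$ is $S$-prime (respectively weakly $S$-prime) if there exists a fixed $s\in S$ such that for all $a\in R$, $m\in M$ with $am\in N$ (respectively $0\neq am\in N$), either $sa\in(N:_{R}M)$ or $sm\in N$. *)

theory Defs
  imports "HOL-Algebra.Module" "HOL-Algebra.Chinese_Remainder"
begin

text \<open>No unit is required in a multiplicatively closed set, and zero may belong to it.\<close>

definition mult_closed :: "('a, 'r) ring_scheme \<Rightarrow> 'a set \<Rightarrow> bool" where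
  "mult_closed R S \<longleftrightarrow>
     S \<subseteq> carrier R \<and> S \<noteq> {} \<and> (\<forall>x\<in>S. \<forall>y\<in>S. x \<otimes>\<^bsub>R\<^esub> y \<in> S)"

definition colon :: "('a, 'r) ring_scheme \<Rightarrow> ('a, 'b, 'm) module_scheme \<Rightarrow> 'b set \<Rightarrow> 'a set" where
  "colon R M N = {r \<in> carrier R. (\<lambda>m. r \<odot>\<^bsub>M\<^esub> m) ` carrier M \<subseteq> N}"

text \<open>In both notions below the element \<open>s\<close> is chosen before \<open>a\<close> and \<open>m\<close>.\<close>

definition S_prime_submodule ::
  "('a, 'r) ring_scheme \<Rightarrow> ('a, 'b, 'm) module_scheme \<Rightarrow> 'a set \<Rightarrow> 'b set \<Rightarrow> bool" where
  "S_prime_submodule R M S N \<longleftrightarrow>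
     submodule N R M \<and> colon R M N \<inter> S = {} \<and>
     (\<exists>s\<in>S. \<forall>a\<in>carrier R. \<forall>m\<in>carrier M. a \<odot>\<^bsub>M\<^esub> m \<in> N \<longrightarrow>
        s \<otimes>\<^bsub>R\<^esub> a \<in> colon R M N \<or> s \<odot>\<^bsub>M\<^esub> m \<in> N)"

definition weakly_S_prime_submodule ::
  "('a, 'r) ring_scheme \<Rightarrow> ('a, 'b, 'm) module_scheme \<Rightarrow> 'a set \<Rightarrow> 'b set \<Rightarrow> bool" where
  "weakly_S_prime_submodule R M S N \<longleftrightarrow>
     submodule N R M \<and> colon R M N \<inter> S = {} \<and>
     (\<exists>s\<in>S. \<forall>a\<in>carrier R. \<forall>m\<in>carrier M. a \<odot>\<^bsub>M\<^esub> m \<noteq> \<zero>\<^bsub>M\<^esub> \<and> a \<odot>\<^bsub>M\<^esub> m \<in> N \<longrightarrow>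
        s \<otimes>\<^bsub>R\<^esub> a \<in> colon R M N \<or> s \<odot>\<^bsub>M\<^esub> m \<in> N)"

text \<open>The product of an \<open>R1\<close>-module and an \<open>R2\<close>-module, a module over
  \<open>RDirProd R1 R2\<close>. The module record extends the ring record, so \<^const>\<open>RDirProd\<close> already
  supplies the carrier and the additive structure; its multiplicative fields play no role
  in a module.\<close>

definition MDirProd ::
  "('a, 'b, 'm) module_scheme \<Rightarrow> ('c, 'd, 'n) module_scheme \<Rightarrow> ('a \<times> 'c, 'b \<times> 'd) module" where
  "MDirProd M1 M2 = ring.extend (RDirProd M1 M2)
     (module.fields (\<lambda>(a1, a2) (m1, m2). (a1 \<odot>\<^bsub>M1\<^esub> m1, a2 \<odot>\<^bsub>M2\<^esub> m2)))"

lemma MDirProd_simps [simp]: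
  "carrier (MDirProd M1 M2) = carrier M1 \<times> carrier M2"
  "\<zero>\<^bsub>MDirProd M1 M2\<^esub> = (\<zero>\<^bsub>M1\<^esub>, \<zero>\<^bsub>M2\<^esub>)"
  "(x1, x2) \<oplus>\<^bsub>MDirProd M1 M2\<^esub> (y1, y2) = (x1 \<oplus>\<^bsub>M1\<^esub> y1, x2 \<oplus>\<^bsub>M2\<^esub> y2)"
  "(a1, a2) \<odot>\<^bsub>MDirProd M1 M2\<^esub> (x1, x2) = (a1 \<odot>\<^bsub>M1\<^esub> x1, a2 \<odot>\<^bsub>M2\<^esub> x2)"
  by (simp_all add: MDirProd_def RDirProd_def DirProd_def
      monoid.defs ring.defs module.defs)

lemma RDirProd_simps:
  "carrier (RDirProd R1 R2) = carrier R1 \<times> carrier R2"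
  "\<zero>\<^bsub>RDirProd R1 R2\<^esub> = (\<zero>\<^bsub>R1\<^esub>, \<zero>\<^bsub>R2\<^esub>)"
  "\<one>\<^bsub>RDirProd R1 R2\<^esub> = (\<one>\<^bsub>R1\<^esub>, \<one>\<^bsub>R2\<^esub>)"
  "(x1, x2) \<oplus>\<^bsub>RDirProd R1 R2\<^esub> (y1, y2) = (x1 \<oplus>\<^bsub>R1\<^esub> y1, x2 \<oplus>\<^bsub>R2\<^esub> y2)"
  "(x1, x2) \<otimes>\<^bsub>RDirProd R1 R2\<^esub> (y1, y2) = (x1 \<otimes>\<^bsub>R1\<^esub> y1, x2 \<otimes>\<^bsub>R2\<^esub> y2)"
  by (simp_all add: RDirProd_def DirProd_def monoid.defs ring.defs)

lemma cring_RDirProd: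
  assumes "cring R1" "cring R2"
  shows "cring (RDirProd R1 R2)"
proof -
  interpret R1: cring R1 by fact
  interpret R2: cring R2 by fact
  interpret P: ring "RDirProd R1 R2"
    by (rule RDirProd_ring[OF R1.ring_axioms R2.ring_axioms])
  show ?thesis
    by unfold_locales (auto simp: RDirProd_simps R1.m_comm R2.m_comm)
qed

lemma module_MDirProd:
  assumes "module R1 M1" "module R2 M2"
  shows "module (RDirProd R1 R2) (MDirProd M1 M2)"
proof -
  interpret m1: module R1 M1 by fact
  interpret m2: module R2 M2 by fact
  have "abelian_group (MDirProd M1 M2)"
  proof (rule abelian_groupI)
    fix x assume "x \<in> carrier (MDirProd M1 M2)"
    then show "\<exists>y\<in>carrier (MDirProd M1 M2). y \<oplus>\<^bsub>MDirProd M1 M2\<^esub> x = \<zero>\<^bsub>MDirProd M1 M2\<^esub>"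
      by (intro bexI[of _ "(\<ominus>\<^bsub>M1\<^esub> fst x, \<ominus>\<^bsub>M2\<^esub> snd x)"]) (auto simp: m1.M.l_neg m2.M.l_neg)
  qed (auto simp: m1.M.a_ac m2.M.a_ac)
  then show ?thesis
    by (intro moduleI cring_RDirProd m1.R.cring_axioms m2.R.cring_axioms)
      (auto simp: RDirProd_simps m1.smult_l_distr m2.smult_l_distr m1.smult_r_distr
        m2.smult_r_distr m1.smult_assoc1 m2.smult_assoc1)
qed

lemma submodule_MDirProd:
  assumes "module R1 M1" "module R2 M2" "submodule N1 R1 M1" "submodule N2 R2 M2"
  shows "submodule (N1 \<times> N2) (RDirProd R1 R2) (MDirProd M1 M2)"
proof -
  interpret m1: module R1 M1 by fact
  interpret m2: module R2 M2 by fact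
  interpret P: module "RDirProd R1 R2" "MDirProd M1 M2"
    by (rule module_MDirProd) fact+
  note n1 = m1.submoduleE[OF assms(3)] and n2 = m2.submoduleE[OF assms(4)]
  have z: "\<zero>\<^bsub>M1\<^esub> \<in> N1" "\<zero>\<^bsub>M2\<^esub> \<in> N2"
    using subgroup.one_closed[OF submodule.axioms(1)[OF assms(3)]]
      subgroup.one_closed[OF submodule.axioms(1)[OF assms(4)]] by simp_all
  have inv: "\<ominus>\<^bsub>MDirProd M1 M2\<^esub> (x, y) = (\<ominus>\<^bsub>M1\<^esub> x, \<ominus>\<^bsub>M2\<^esub> y)" if "x \<in> carrier M1" "y \<in> carrier M2" for x y
    using that by (intro P.M.minus_equality) (auto simp: m1.M.l_neg m2.M.l_neg)
  show ?thesis
  proof (rule P.submoduleI)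
    fix a assume "a \<in> N1 \<times> N2"
    then show "\<ominus>\<^bsub>MDirProd M1 M2\<^esub> a \<in> N1 \<times> N2"
      using n1(1,3) n2(1,3) by (auto simp: inv subset_iff)
  qed (use n1 n2 z in \<open>auto simp: RDirProd_simps\<close>)
qed

end

theory Submission
  imports Defs
begin

text \<open>
  Membership in \<open>N1 \<times> N2\<close>, in its colon ideal and in \<open>S1 \<times> S2\<close> is decided in each
  coordinate, so only one coordinate needs to carry the primeness condition: if some
  \<open>t \<in> S2\<close> lies in \<open>(N2 : M2)\<close>, then \<open>t\<close> makes every condition in the second coordinate
  true, and a witness \<open>s\<close> for \<open>N1\<close> yields the witness \<open>(s, t)\<close> for \<open>N1 \<times> N2\<close>
  (lemma \<open>S_prime_submodule_MDirProd\<close>).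

  Conversely, \<open>N1\<close> and \<open>N2\<close> being non-zero makes weak primeness of \<open>N1 \<times> N2\<close> as strong
  as primeness. A vector \<open>(n, m)\<close> with \<open>0 \<noteq> n \<in> N1\<close>, multiplied by \<open>(1, a)\<close>, stays non-zero
  whatever happens in the second coordinate; this gives the primeness condition of \<open>N2\<close>
  without the restriction to non-zero products. The scalar \<open>(1, 0)\<close> then shows that one of
  the two components of the witness lies in its colon ideal
  (lemma \<open>weakly_S_prime_submodule_MDirProdD\<close>). As the product colon ideal misses
  \<open>S1 \<times> S2\<close>, one of the two colon ideals misses its multiplicative set, and the other one
  therefore meets it. The two alternatives are exchanged by swapping the factors.
\<close>

lemma colon_MDirProd:
  assumes "module R1 M1" "module R2 M2"
  shows "colon (RDirProd R1 R2) (MDirProd M1 M2) (N1 \<times> N2) = colon R1 M1 N1 \<times> colon R2 M2 N2"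
proof -
  interpret m1: module R1 M1 by fact
  interpret m2: module R2 M2 by fact
  show ?thesis
    \<comment> \<open>The zero vectors witness that neither module is empty, so each factor can be tested alone.\<close>
    using m1.M.zero_closed m2.M.zero_closed
    by (fastforce simp: colon_def RDirProd_simps image_subset_iff)
qed

lemma submodule_zero_mem:
  assumes "submodule N R M"
  shows "\<zero>\<^bsub>M\<^esub> \<in> N"
  using subgroup.one_closed[OF submodule.axioms(1)[OF assms]] by simp

lemma colon_mult:
  assumes "module R M" "s \<in> colon R M N" "a \<in> carrier R"
  shows "s \<otimes>\<^bsub>R\<^esub> a \<in> colon R M N"
proof -
  interpret module R M by fact
  show ?thesis
    using assms(2,3) by (auto simp: colon_def image_subset_iff smult_assoc1)
qed

lemma S_prime_imp_weakly_S_prime: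
  "S_prime_submodule R M S N \<Longrightarrow> weakly_S_prime_submodule R M S N"
  unfolding S_prime_submodule_def weakly_S_prime_submodule_def by blast

text \<open>The swap of the two factors is an isomorphism that respects all the data; it reduces each
  direction of the equivalence to one order of the factors.\<close>

lemma S_prime_submodule_MDirProd_swap:
  assumes "module R1 M1" "module R2 M2" "submodule N1 R1 M1" "submodule N2 R2 M2"
    and "S_prime_submodule (RDirProd R1 R2) (MDirProd M1 M2) (S1 \<times> S2) (N1 \<times> N2)"
  shows "S_prime_submodule (RDirProd R2 R1) (MDirProd M2 M1) (S2 \<times> S1) (N2 \<times> N1)"
  using assms(5) submodule_MDirProd[OF assms(2,1,4,3)]
  unfolding S_prime_submodule_def colon_MDirProd[OF assms(1,2)] colon_MDirProd[OF assms(2,1)]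
  by (fastforce simp: RDirProd_simps)

lemma weakly_S_prime_submodule_MDirProd_swap:
  assumes "module R1 M1" "module R2 M2" "submodule N1 R1 M1" "submodule N2 R2 M2"
    and "weakly_S_prime_submodule (RDirProd R1 R2) (MDirProd M1 M2) (S1 \<times> S2) (N1 \<times> N2)"
  shows "weakly_S_prime_submodule (RDirProd R2 R1) (MDirProd M2 M1) (S2 \<times> S1) (N2 \<times> N1)"
  using assms(5) submodule_MDirProd[OF assms(2,1,4,3)]
  unfolding weakly_S_prime_submodule_def colon_MDirProd[OF assms(1,2)] colon_MDirProd[OF assms(2,1)]
  by (fastforce simp: RDirProd_simps)

text \<open>An element \<open>t \<in> (N2 : M2) \<inter> S2\<close> sends all of \<open>M2\<close> into \<open>N2\<close>, and so does each of its
  multiples; paired with a witness for \<open>N1\<close> it is a witness for the product.\<close>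

lemma S_prime_submodule_MDirProd:
  assumes mod: "module R1 M1" "module R2 M2"
    and sub: "submodule N2 R2 M2"
    and prime: "S_prime_submodule R1 M1 S1 N1"
    and meet: "colon R2 M2 N2 \<inter> S2 \<noteq> {}"
  shows "S_prime_submodule (RDirProd R1 R2) (MDirProd M1 M2) (S1 \<times> S2) (N1 \<times> N2)"
proof -
  from prime have sub1: "submodule N1 R1 M1" and disj: "colon R1 M1 N1 \<inter> S1 = {}"
    by (simp_all add: S_prime_submodule_def)
  from prime obtain s where s: "s \<in> S1"
    and s_prime: "\<And>a m. a \<in> carrier R1 \<Longrightarrow> m \<in> carrier M1 \<Longrightarrow> a \<odot>\<^bsub>M1\<^esub> m \<in> N1 \<Longrightarrow>
      s \<otimes>\<^bsub>R1\<^esub> a \<in> colon R1 M1 N1 \<or> s \<odot>\<^bsub>M1\<^esub> m \<in> N1"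
    unfolding S_prime_submodule_def by blast
  from meet obtain t where t: "t \<in> S2" and t_colon: "t \<in> colon R2 M2 N2"
    by blast
  have t_vec: "t \<odot>\<^bsub>M2\<^esub> m \<in> N2" if "m \<in> carrier M2" for m
    using t_colon that by (auto simp: colon_def)
  have "\<forall>a\<in>carrier (RDirProd R1 R2). \<forall>m\<in>carrier (MDirProd M1 M2).
      a \<odot>\<^bsub>MDirProd M1 M2\<^esub> m \<in> N1 \<times> N2 \<longrightarrow>
      (s, t) \<otimes>\<^bsub>RDirProd R1 R2\<^esub> a \<in> colon R1 M1 N1 \<times> colon R2 M2 N2 \<or>
      (s, t) \<odot>\<^bsub>MDirProd M1 M2\<^esub> m \<in> N1 \<times> N2"
    using s_prime t_vec colon_mult[OF mod(2) t_colon] by (auto simp: RDirProd_simps)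
  with s t disj submodule_MDirProd[OF mod sub1 sub] show ?thesis
    unfolding S_prime_submodule_def colon_MDirProd[OF mod] by blast
qed

text \<open>A non-zero \<open>n \<in> N1\<close> in the first coordinate keeps products non-zero, so that weak
  primeness of \<open>N1 \<times> N2\<close> applies to all products in the second coordinate, including those
  that are zero there.\<close>

lemma weakly_S_prime_submodule_MDirProdD:
  assumes mod: "module R1 M1" "module R2 M2"
    and sub: "submodule N1 R1 M1" "submodule N2 R2 M2"
    and closed: "S1 \<subseteq> carrier R1" "S2 \<subseteq> carrier R2"
    and nz: "N1 \<noteq> {\<zero>\<^bsub>M1\<^esub>}"
    and weak: "weakly_S_prime_submodule (RDirProd R1 R2) (MDirProd M1 M2) (S1 \<times> S2) (N1 \<times> N2)"
    and disj: "colon R2 M2 N2 \<inter> S2 = {}"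
  shows "S_prime_submodule R2 M2 S2 N2 \<and> colon R1 M1 N1 \<inter> S1 \<noteq> {}"
proof -
  interpret m1: module R1 M1 by fact
  interpret m2: module R2 M2 by fact
  from weak obtain s t where s: "s \<in> S1" and t: "t \<in> S2"
    and st: "\<And>a b m n. a \<in> carrier R1 \<Longrightarrow> b \<in> carrier R2 \<Longrightarrow> m \<in> carrier M1 \<Longrightarrow> n \<in> carrier M2 \<Longrightarrow>
      a \<odot>\<^bsub>M1\<^esub> m \<noteq> \<zero>\<^bsub>M1\<^esub> \<Longrightarrow> a \<odot>\<^bsub>M1\<^esub> m \<in> N1 \<Longrightarrow> b \<odot>\<^bsub>M2\<^esub> n \<in> N2 \<Longrightarrow>
      s \<otimes>\<^bsub>R1\<^esub> a \<in> colon R1 M1 N1 \<and> t \<otimes>\<^bsub>R2\<^esub> b \<in> colon R2 M2 N2 \<or>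
      s \<odot>\<^bsub>M1\<^esub> m \<in> N1 \<and> t \<odot>\<^bsub>M2\<^esub> n \<in> N2"
    unfolding weakly_S_prime_submodule_def colon_MDirProd[OF mod]
    by (fastforce simp: RDirProd_simps)
  from nz submodule_zero_mem[OF sub(1)] obtain n where n: "n \<in> N1" "n \<noteq> \<zero>\<^bsub>M1\<^esub>"
    by blast
  have n_carrier: "n \<in> carrier M1"
    using m1.submoduleE(1)[OF sub(1)] n(1) by blast
  have key: "s \<otimes>\<^bsub>R1\<^esub> \<one>\<^bsub>R1\<^esub> \<in> colon R1 M1 N1 \<and> t \<otimes>\<^bsub>R2\<^esub> b \<in> colon R2 M2 N2 \<or>
      t \<odot>\<^bsub>M2\<^esub> m \<in> N2"
    if "b \<in> carrier R2" "m \<in> carrier M2" "b \<odot>\<^bsub>M2\<^esub> m \<in> N2" for b m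
    using st[of "\<one>\<^bsub>R1\<^esub>" b n m] that n n_carrier by auto
  have prime: "S_prime_submodule R2 M2 S2 N2"
    unfolding S_prime_submodule_def using sub(2) disj t key by blast
  have sR: "s \<in> carrier R1" and tR: "t \<in> carrier R2"
    using s t closed by auto
  have "t \<notin> colon R2 M2 N2"
    using t disj by blast
  then obtain m where m: "m \<in> carrier M2" "t \<odot>\<^bsub>M2\<^esub> m \<notin> N2"
    using tR by (auto simp: colon_def)
  \<comment> \<open>The scalar \<open>(1, 0)\<close> maps \<open>(n, m)\<close> to the non-zero vector \<open>(n, 0)\<close> of the product;
    as \<open>t\<close> does not send \<open>m\<close> into \<open>N2\<close>, the colon alternative must hold.\<close>
  have "\<zero>\<^bsub>R2\<^esub> \<odot>\<^bsub>M2\<^esub> m \<in> N2"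
    using m(1) submodule_zero_mem[OF sub(2)] by simp
  with key[of "\<zero>\<^bsub>R2\<^esub>" m] m sR have "s \<in> colon R1 M1 N1"
    by simp
  with s have "colon R1 M1 N1 \<inter> S1 \<noteq> {}"
    by blast
  with prime show ?thesis ..
qed

theorem theorem5:
  fixes R1 :: "('a, 'r) ring_scheme" and R2 :: "('c, 's) ring_scheme"
    and M1 :: "('a, 'b, 'm) module_scheme" and M2 :: "('c, 'd, 'n) module_scheme"
    and S1 :: "'a set" and S2 :: "'c set" and N1 :: "'b set" and N2 :: "'d set"
  assumes "cring R1" and "\<one>\<^bsub>R1\<^esub> \<noteq> \<zero>\<^bsub>R1\<^esub>"
    and "cring R2" and "\<one>\<^bsub>R2\<^esub> \<noteq> \<zero>\<^bsub>R2\<^esub>"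
    and "mult_closed R1 S1" and "mult_closed R2 S2"
    and "module R1 M1" and "module R2 M2"
    and "submodule N1 R1 M1" and "N1 \<noteq> {\<zero>\<^bsub>M1\<^esub>}"
    and "submodule N2 R2 M2" and "N2 \<noteq> {\<zero>\<^bsub>M2\<^esub>}"
  defines "R \<equiv> RDirProd R1 R2" and "M \<equiv> MDirProd M1 M2"
    and "S \<equiv> S1 \<times> S2" and "N \<equiv> N1 \<times> N2"
  shows "(weakly_S_prime_submodule R M S N \<longleftrightarrow>
            (S_prime_submodule R1 M1 S1 N1 \<and> colon R2 M2 N2 \<inter> S2 \<noteq> {}) \<or>
            (S_prime_submodule R2 M2 S2 N2 \<and> colon R1 M1 N1 \<inter> S1 \<noteq> {})) \<and>
         (((S_prime_submodule R1 M1 S1 N1 \<and> colon R2 M2 N2 \<inter> S2 \<noteq> {}) \<or>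
            (S_prime_submodule R2 M2 S2 N2 \<and> colon R1 M1 N1 \<inter> S1 \<noteq> {})) \<longleftrightarrow>
          S_prime_submodule R M S N)"
proof -
  have S1: "S1 \<subseteq> carrier R1" and S2: "S2 \<subseteq> carrier R2"
    using assms(5,6) by (simp_all add: mult_closed_def)
  note mod = assms(7,8) and sub = assms(9,11)
  have dich: "colon R1 M1 N1 \<inter> S1 = {} \<or> colon R2 M2 N2 \<inter> S2 = {}"
    if "weakly_S_prime_submodule R M S N"
    using that unfolding weakly_S_prime_submodule_def R_def M_def S_def N_def
      colon_MDirProd[OF mod] by blast
  have "(S_prime_submodule R1 M1 S1 N1 \<and> colon R2 M2 N2 \<inter> S2 \<noteq> {}) \<or>
        (S_prime_submodule R2 M2 S2 N2 \<and> colon R1 M1 N1 \<inter> S1 \<noteq> {})"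
    if weak: "weakly_S_prime_submodule R M S N"
    using dich[OF weak]
  proof
    assume disj: "colon R1 M1 N1 \<inter> S1 = {}"
    have "weakly_S_prime_submodule (RDirProd R2 R1) (MDirProd M2 M1) (S2 \<times> S1) (N2 \<times> N1)"
      using weak unfolding R_def M_def S_def N_def
      by (rule weakly_S_prime_submodule_MDirProd_swap[OF mod sub])
    from weakly_S_prime_submodule_MDirProdD[OF assms(8,7,11,9) S2 S1 assms(12) this disj]
    show ?thesis ..
  next
    assume disj: "colon R2 M2 N2 \<inter> S2 = {}"
    from weakly_S_prime_submodule_MDirProdD[OF mod sub S1 S2 assms(10)
        weak[unfolded R_def M_def S_def N_def] disj]
    show ?thesis ..
  qed
  moreover have "S_prime_submodule R M S N"
    if "(S_prime_submodule R1 M1 S1 N1 \<and> colon R2 M2 N2 \<inter> S2 \<noteq> {}) \<or>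
        (S_prime_submodule R2 M2 S2 N2 \<and> colon R1 M1 N1 \<inter> S1 \<noteq> {})"
    using that
  proof
    assume "S_prime_submodule R1 M1 S1 N1 \<and> colon R2 M2 N2 \<inter> S2 \<noteq> {}"
    then show ?thesis
      unfolding R_def M_def S_def N_def by (blast intro: S_prime_submodule_MDirProd[OF mod sub(2)])
  next
    assume "S_prime_submodule R2 M2 S2 N2 \<and> colon R1 M1 N1 \<inter> S1 \<noteq> {}"
    then have "S_prime_submodule (RDirProd R2 R1) (MDirProd M2 M1) (S2 \<times> S1) (N2 \<times> N1)"
      by (blast intro: S_prime_submodule_MDirProd[OF assms(8,7) sub(1)])
    then show ?thesis
      unfolding R_def M_def S_def N_def
      by (rule S_prime_submodule_MDirProd_swap[OF assms(8,7,11,9)])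
  qed
  ultimately show ?thesis
    using S_prime_imp_weakly_S_prime by blast
qed

end
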